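(* Let $\mathscr{H}$ be a complex Hilbert space and let $S_1,\dots,S_n\in\mathscr{B}(\mathscr{H})$. Then $$\max\left\{w_{\rm e}(S_1,\dots,S_n),\,w_{\rm e}\left(|S_1|^2,\dots,|S_n|^2\right)\right\}\le dw_{\rm e}(S_1,\dots,S_n)\le w_{\rm e}(S_1,\dots,S_n)+w_{\rm e}\left(|S_1|^2,\dots,|S_n|^2\right).$$
   Context: $\mathscr{B}(\mathscr{H})$ is the algebra of bounded linear operators on $\mathscr{H}$ and $|A|=(A^*A)^{1/2}$. For $T_1,\dots,T_n\in\mathscr{B}(\mathscr{H})$ the Euclidean operator radius is $w_{\rm e}(T_1,\dots,T_n)=\sup_{\|x\|=1}\left(\sum_{i=1}^n|\langle T_ix,x\rangle|^2\right)^{1/2}$, and the Euclidean Davis--Wielandt radius is $dw_{\rm e}(S_1,\dots,S_n)=\sup_{\|x\|=1}\left(\sum_{i=1}^n\left(|\langle S_ix,x\rangle|^2+\|S_ix\|^4\right)\right)^{1/2}$, suprema over unit vectors $x\in\mathscr{H}$. *)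

theory Defs
  imports "HOL-Analysis.Analysis"
begin

class complex_vector = real_vector +
  fixes scaleC :: "complex \<Rightarrow> 'a \<Rightarrow> 'a"  (infixr "*\<^sub>C" 75)
  assumes scaleC_add_right: "c *\<^sub>C (x + y) = c *\<^sub>C x + c *\<^sub>C y"
    and scaleC_add_left: "(c + d) *\<^sub>C x = c *\<^sub>C x + d *\<^sub>C x"
    and scaleC_scaleC: "c *\<^sub>C (d *\<^sub>C x) = (c * d) *\<^sub>C x"
    and scaleR_scaleC: "r *\<^sub>R x = complex_of_real r *\<^sub>C x"

text \<open>The inner product is linear in its first argument. The last axiom identifies the library's
  real inner product with the real part of the complex one, so that the norm, which in
  \<^class>\<open>real_inner\<close> is the square root of \<open>inner x x\<close>, is the one induced by \<open>cinner\<close>.\<close>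

class complex_inner = complex_vector + real_inner +
  fixes cinner :: "'a \<Rightarrow> 'a \<Rightarrow> complex"
  assumes cinner_commute: "cinner x y = cnj (cinner y x)"
    and cinner_add_left: "cinner (x + y) z = cinner x z + cinner y z"
    and cinner_scaleC_left: "cinner (c *\<^sub>C x) y = c * cinner x y"
    and inner_eq_Re_cinner: "inner x y = Re (cinner x y)"

class chilbert_space = complex_inner + complete_space

instantiation complex :: chilbert_space
begin

definition scaleC_complex :: "complex \<Rightarrow> complex \<Rightarrow> complex"
  where "scaleC_complex c z = c * z"

definition cinner_complex :: "complex \<Rightarrow> complex \<Rightarrow> complex"
  where "cinner_complex z w = z * cnj w"

instance
  by standard
    (auto simp: scaleC_complex_def cinner_complex_def algebra_simps scaleR_conv_of_real
      inner_complex_def)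

end

definition bounded_clinear :: "('a::complex_inner \<Rightarrow> 'b::complex_inner) \<Rightarrow> bool"
  where "bounded_clinear A \<longleftrightarrow> bounded_linear A \<and> (\<forall>c x. A (c *\<^sub>C x) = c *\<^sub>C A x)"

definition cadjoint :: "('a::chilbert_space \<Rightarrow> 'b::chilbert_space) \<Rightarrow> 'b \<Rightarrow> 'a"
  where "cadjoint A = (SOME B. \<forall>x y. cinner (A x) y = cinner x (B y))"

definition positive_op :: "('a::complex_inner \<Rightarrow> 'a) \<Rightarrow> bool"
  where "positive_op P \<longleftrightarrow> bounded_clinear P \<and> (\<forall>x. cinner (P x) x \<in> \<real>\<^sub>\<ge>\<^sub>0)"

text \<open>A positive operator on a Hilbert space has exactly one positive square root, so the choice
  below is unambiguous whenever \<open>A\<close> is bounded and complex linear.\<close>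

definition op_abs :: "('a::chilbert_space \<Rightarrow> 'b::chilbert_space) \<Rightarrow> 'a \<Rightarrow> 'a"
  where "op_abs A = (SOME P. positive_op P \<and> P \<circ> P = cadjoint A \<circ> A)"

text \<open>Both radii are suprema of nonnegative numbers over the unit sphere. Inserting \<open>0\<close> changes
  nothing unless the sphere is empty, that is, unless the space is trivial; the supremum, taken in
  the nonnegative reals, is then \<open>0\<close>, whereas \<open>Sup {}\<close> is unspecified in \<^typ>\<open>real\<close>.\<close>

definition euclidean_radius :: "nat \<Rightarrow> (nat \<Rightarrow> 'a::complex_inner \<Rightarrow> 'a) \<Rightarrow> real"
  where "euclidean_radius n T =
    Sup (insert 0 {sqrt (\<Sum>i=1..n. (cmod (cinner (T i x) x))\<^sup>2) | x. norm x = 1})"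

definition euclidean_dw_radius :: "nat \<Rightarrow> (nat \<Rightarrow> 'a::complex_inner \<Rightarrow> 'a) \<Rightarrow> real"
  where "euclidean_dw_radius n S =
    Sup (insert 0
      {sqrt (\<Sum>i=1..n. ((cmod (cinner (S i x) x))\<^sup>2 + norm (S i x) ^ 4)) | x. norm x = 1})"

end

theory Submission imports Defs
begin

text \<open>Since \<open>(op_abs A)\<^sup>2 = A* A\<close>, the form of \<open>(op_abs A)\<^sup>2\<close> at \<open>x\<close> is
  \<open>(norm (A x))\<^sup>2\<close>, and the three radii are suprema of \<open>sqrt (a x)\<close>, \<open>sqrt (b x)\<close> and
  \<open>sqrt (a x + b x)\<close> for the same nonnegative \<open>a\<close>, \<open>b\<close>. The substance is that
  the choices in \<open>cadjoint\<close> and \<open>op_abs\<close> have witnesses: the adjoint by Riesz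
  representation, the square root by the power series of \<open>sqrt (1 - z)\<close> at the contraction
  \<open>I - t A* A\<close> for small \<open>t > 0\<close>.\<close>

section \<open>Sesquilinearity, the norm and Cauchy-Schwarz for the complex inner product\<close>

lemma cinner_add_right: "cinner x (y + z) = cinner x y + cinner x z"
  by (metis cinner_add_left cinner_commute complex_cnj_add)

lemma cinner_scaleC_right: "cinner x (c *\<^sub>C y) = cnj c * cinner x y"
  by (metis cinner_commute cinner_scaleC_left complex_cnj_mult)

lemma cinner_scaleR_left: "cinner (r *\<^sub>R x) y = r *\<^sub>R cinner x y"
  by (simp add: scaleR_scaleC[of r x] cinner_scaleC_left scaleR_conv_of_real)

lemma cinner_scaleR_right: "cinner x (r *\<^sub>R y) = r *\<^sub>R cinner x y"
  by (simp add: scaleR_scaleC[of r y] cinner_scaleC_right scaleR_conv_of_real)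

lemma cinner_diff_left: "cinner (x - y) z = cinner x z - cinner y z"
  using cinner_add_left[of "x - y" y z] by simp

lemma cinner_diff_right: "cinner x (y - z) = cinner x y - cinner x z"
  using cinner_add_right[of x "y - z" z] by simp

lemma cinner_self: "cinner x x = complex_of_real ((norm x)\<^sup>2)"
proof (rule complex_eqI)
  show "Re (cinner x x) = Re (complex_of_real ((norm x)\<^sup>2))"
    by (simp add: inner_eq_Re_cinner[symmetric] power2_norm_eq_inner)
  show "Im (cinner x x) = Im (complex_of_real ((norm x)\<^sup>2))"
    using arg_cong[OF cinner_commute[of x x], of Im] by simp
qed

lemma norm_scaleC: "norm (c *\<^sub>C (x::'a::complex_inner)) = cmod c * norm x"
proof -
  have "complex_of_real ((norm (c *\<^sub>C x))\<^sup>2) = (c * cnj c) * cinner x x"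
    by (simp only: cinner_self[symmetric] cinner_scaleC_left cinner_scaleC_right mult_ac)
  also have "\<dots> = complex_of_real ((cmod c * norm x)\<^sup>2)"
    by (simp only: complex_norm_square[symmetric] cinner_self power_mult_distrib of_real_mult)
  finally have "(norm (c *\<^sub>C x))\<^sup>2 = (cmod c * norm x)\<^sup>2"
    by (simp only: of_real_eq_iff)
  then show ?thesis
    by (simp add: power2_eq_iff_nonneg)
qed

text \<open>Rotating \<open>x\<close> by the conjugate phase of \<open>cinner x y\<close> makes the
  inner product real and nonnegative without changing \<open>norm x\<close>, so the real
  Cauchy-Schwarz inequality applies.\<close>

lemma norm_cinner_le: "cmod (cinner x y) \<le> norm x * norm y"
proof (cases "cinner x y = 0")
  case False
  define c where "c = cnj (sgn (cinner x y))"
  have c: "cmod c = 1"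
    using False by (simp add: c_def norm_sgn)
  have "c * cinner x y = complex_of_real (cmod (cinner x y))"
    using False
    by (simp add: c_def sgn_div_norm scaleR_conv_of_real field_simps)
       (metis complex_norm_square of_real_power power2_eq_square)
  then have "cmod (cinner x y) = inner (c *\<^sub>C x) y"
    by (simp add: inner_eq_Re_cinner cinner_scaleC_left)
  also have "\<dots> \<le> norm (c *\<^sub>C x) * norm y"
    by (rule norm_cauchy_schwarz)
  finally show ?thesis
    by (simp add: norm_scaleC c)
qed simp

lemma cinner_eqI:
  assumes "\<And>x. cinner x y = cinner x z"
  shows "y = z"
proof -
  have "cinner (y - z) (y - z) = 0"
    using assms by (simp add: cinner_diff_right)
  then show ?thesis
    by (simp add: cinner_self)
qed

lemma bounded_linear_cinner_left: "bounded_linear (\<lambda>x. cinner x y)"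
  by (rule bounded_linear_intro[where K = "norm y"])
     (simp_all add: cinner_add_left cinner_scaleR_left norm_cinner_le)

lemma bounded_linear_cinner_right: "bounded_linear (cinner x)"
  by (rule bounded_linear_intro[where K = "norm x"])
     (simp_all add: cinner_add_right cinner_scaleR_right norm_cinner_le mult.commute[of _ "norm x"])

lemma bounded_linear_scaleC: "bounded_linear ((*\<^sub>C) c :: 'a::complex_inner \<Rightarrow> 'a)"
  by (rule bounded_linear_intro[where K = "cmod c"])
     (simp_all add: scaleC_add_right scaleR_scaleC scaleC_scaleC norm_scaleC mult.commute)

lemma bounded_clinear_intro:
  assumes "\<And>x y. A (x + y) = A x + A y"
    and scaleC: "\<And>c x. A (c *\<^sub>C x) = c *\<^sub>C A x"
    and "\<And>x. norm (A x) \<le> norm x * K"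
  shows "bounded_clinear A"
  unfolding bounded_clinear_def
  by (intro conjI allI bounded_linear_intro[where K = K]) (simp_all add: assms scaleR_scaleC)

instance chilbert_space \<subseteq> banach ..

section \<open>The adjoint\<close>

text \<open>The representing vector minimises \<open>(norm z)\<^sup>2 - 2 * f z\<close>; by the parallelogram law
  every minimising sequence is Cauchy.\<close>

lemma riesz_representation:
  fixes f :: "'a::{real_inner, complete_space} \<Rightarrow> real"
  assumes "bounded_linear f"
  shows "\<exists>z. \<forall>x. f x = inner x z"
proof -
  interpret f: bounded_linear f by fact
  obtain K where K: "\<And>x. norm (f x) \<le> norm x * K"
    using f.bounded by blast
  define q where "q z = (norm z)\<^sup>2 - 2 * f z" for z
  have q_ge: "q z \<ge> - K\<^sup>2" for z
  proof -
    have "0 \<le> (norm z - K)\<^sup>2" by simp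
    moreover have "f z \<le> norm z * K" using K[of z] by (simp add: abs_le_iff)
    ultimately show ?thesis by (simp add: q_def power2_diff)
  qed
  define m where "m = (INF z. q z)"
  have bdd: "bdd_below (range q)"
    using q_ge by (intro bdd_belowI2[where m = "- K\<^sup>2"]) auto
  have m_le: "m \<le> q z" for z
    unfolding m_def by (rule cINF_lower[OF bdd]) simp
  have "\<exists>z. q z < m + 1 / real (Suc n)" for n
    using cINF_less_iff[OF _ bdd, of "m + 1 / real (Suc n)"] by (simp add: m_def)
  then obtain u where u: "\<And>n. q (u n) < m + 1 / real (Suc n)"
    by metis
  have para: "(norm (x - y))\<^sup>2 \<le> 2 * (q x - m) + 2 * (q y - m)" for x y
  proof -
    \<comment> \<open>The terms in \<open>f\<close> agree on both sides by linearity, which leaves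
      the parallelogram law. Since \<open>q\<close> is at least \<open>m\<close> at the midpoint,
      the distance is controlled by the excesses over \<open>m\<close>.\<close>
    have "q x + q y = 2 * q ((1/2) *\<^sub>R (x + y)) + (norm (x - y))\<^sup>2 / 2"
      unfolding q_def f.scaleR f.add power2_norm_eq_inner
      by (simp add: inner_add inner_diff inner_commute[of y x] field_simps)
    with m_le[of "(1/2) *\<^sub>R (x + y)"] show ?thesis by argo
  qed
  have q_lim: "(\<lambda>n. q (u n)) \<longlonglongrightarrow> m"
  proof (rule tendsto_sandwich[where f = "\<lambda>_. m"])
    show "(\<lambda>n. m + 1 / real (Suc n)) \<longlonglongrightarrow> m"
      using tendsto_add[OF tendsto_const LIMSEQ_inverse_real_of_nat, of m]
      by (simp add: inverse_eq_divide)
    show "\<forall>\<^sub>F n in sequentially. q (u n) \<le> m + 1 / real (Suc n)"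
      using u by (intro always_eventually allI less_imp_le)
  qed (use m_le in simp_all)
  have "Cauchy u"
  proof (rule metric_CauchyI)
    fix e :: real assume "0 < e"
    then have "\<forall>\<^sub>F n in sequentially. q (u n) < m + e\<^sup>2 / 4"
      using order_tendstoD(2)[OF q_lim] by simp
    then obtain N where N: "\<And>n. n \<ge> N \<Longrightarrow> q (u n) < m + e\<^sup>2 / 4"
      by (auto simp: eventually_sequentially)
    have "dist (u i) (u j) < e" if "i \<ge> N" "j \<ge> N" for i j
    proof -
      have "(norm (u i - u j))\<^sup>2 < e\<^sup>2"
        using para[of "u i" "u j"] N[OF that(1)] N[OF that(2)] by simp
      then show ?thesis
        using \<open>0 < e\<close> by (simp add: dist_norm power_less_imp_less_base)
    qed
    then show "\<exists>M. \<forall>i\<ge>M. \<forall>j\<ge>M. dist (u i) (u j) < e"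
      by blast
  qed
  then obtain z where z: "u \<longlonglongrightarrow> z"
    by (meson Cauchy_convergent convergentD)
  have "(\<lambda>n. q (u n)) \<longlonglongrightarrow> q z"
    unfolding q_def by (intro tendsto_intros z f.tendsto)
  then have qz: "q z = m"
    by (rule LIMSEQ_unique[OF _ q_lim])
  have "f x = inner x z" for x
  proof (cases "x = 0")
    case False
    define a where "a = inner x z - f x"
    define N where "N = (norm x)\<^sup>2"
    have N: "0 < N"
      using False by (simp add: N_def)
    \<comment> \<open>This \<open>t\<close> minimises the quadratic
      \<open>2 * t * a + t\<^sup>2 * N\<close>, the change of \<open>q\<close> along
      \<open>x\<close>. The resulting drop by \<open>a\<^sup>2 / N\<close> contradicts minimality at
      \<open>z\<close> unless \<open>a = 0\<close>.\<close>
    define t where "t = - a / N"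
    have "q (z + t *\<^sub>R x) = q z + 2 * t * a + t\<^sup>2 * N"
      unfolding q_def f.scaleR f.add power2_norm_eq_inner a_def N_def
      by (simp add: inner_add inner_commute[of z x] algebra_simps power2_eq_square)
    also have "\<dots> = q z - a\<^sup>2 / N"
    proof -
      have "t\<^sup>2 * N = t * (t * N)"
        by (simp add: power2_eq_square)
      also have "t * N = - a"
        using N by (simp add: t_def)
      finally have "2 * t * a + t\<^sup>2 * N = t * a"
        by simp
      also have "t * a = - (a\<^sup>2 / N)"
        by (simp add: t_def power2_eq_square)
      finally show ?thesis by simp
    qed
    finally have "a\<^sup>2 / N \<le> 0"
      using m_le[of "z + t *\<^sub>R x"] qz by simp
    then show ?thesis
      using N by (simp add: divide_le_0_iff a_def)
  qed simp
  then show ?thesis by blast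
qed

text \<open>The real Riesz theorem, applied to the real part of the form, yields the representing
  vector. Replacing \<open>x\<close> by \<open>\<i> *\<^sub>C x\<close> then turns agreement of real
  parts into agreement of imaginary parts.\<close>

lemma cinner_cadjoint:
  fixes A :: "'a::chilbert_space \<Rightarrow> 'b::chilbert_space"
  assumes "bounded_clinear A"
  shows "cinner (A x) y = cinner x (cadjoint A y)"
proof -
  have A: "bounded_linear A" and scaleC: "\<And>c x. A (c *\<^sub>C x) = c *\<^sub>C A x"
    using assms by (auto simp: bounded_clinear_def)
  have "\<exists>z. \<forall>x. cinner (A x) y = cinner x z" for y
  proof -
    obtain z where z: "\<And>x. inner (A x) y = inner x z"
      using riesz_representation[OF bounded_linear_inner_left_comp[OF A, of y]] by blast
    have "cinner (A x) y = cinner x z" for x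
    proof (rule complex_eqI)
      show "Re (cinner (A x) y) = Re (cinner x z)"
        using z[of x] by (simp add: inner_eq_Re_cinner)
      show "Im (cinner (A x) y) = Im (cinner x z)"
        using z[of "\<i> *\<^sub>C x"] by (simp add: inner_eq_Re_cinner scaleC cinner_scaleC_left)
    qed
    then show ?thesis by blast
  qed
  then have "\<exists>B. \<forall>x y. cinner (A x) y = cinner x (B y)"
    by metis
  from someI_ex[OF this, folded cadjoint_def] show ?thesis
    by blast
qed

text \<open>Linearity follows because a vector is determined by its inner products. A bound
  \<open>K\<close> for \<open>A\<close> also bounds the adjoint, by Cauchy-Schwarz applied to the
  form of \<open>A \<circ> cadjoint A\<close> at \<open>y\<close>.\<close>

lemma bounded_clinear_cadjoint:
  fixes A :: "'a::chilbert_space \<Rightarrow> 'b::chilbert_space"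
  assumes "bounded_clinear A"
  shows "bounded_clinear (cadjoint A)"
proof -
  note adj = cinner_cadjoint[OF assms, symmetric]
  obtain K where K: "\<And>x. norm (A x) \<le> norm x * K" "0 \<le> K"
    using assms bounded_linear.nonneg_bounded unfolding bounded_clinear_def by blast
  show ?thesis
  proof (rule bounded_clinear_intro)
    show "cadjoint A (x + y) = cadjoint A x + cadjoint A y" for x y
      by (rule cinner_eqI) (simp add: cinner_add_right adj)
    show "cadjoint A (c *\<^sub>C x) = c *\<^sub>C cadjoint A x" for c x
      by (rule cinner_eqI) (simp add: cinner_scaleC_right adj)
    show "norm (cadjoint A y) \<le> norm y * K" for y
    \<comment> \<open>The estimate carries one factor \<open>norm (cadjoint A y)\<close> too many on
      each side; it can be cancelled only when nonzero.\<close>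
    proof (cases "cadjoint A y = 0")
      case False
      have "(norm (cadjoint A y))\<^sup>2 = cmod (cinner (A (cadjoint A y)) y)"
        unfolding cinner_cadjoint[OF assms] cinner_self norm_of_real by simp
      also have "\<dots> \<le> norm (A (cadjoint A y)) * norm y"
        by (rule norm_cinner_le)
      also have "\<dots> \<le> (norm (cadjoint A y) * K) * norm y"
        using K by (intro mult_right_mono) auto
      finally show ?thesis
        using False by (simp add: power2_eq_square mult.assoc mult.commute)
    qed (use K in simp)
  qed
qed

section \<open>Square roots of positive operators\<close>

text \<open>Both sides sum \<open>(a n * b m) *\<^sub>R v (n + m)\<close> over all pairs, by rows
  and by antidiagonals. The double family is absolutely summable because it is dominated by
  \<open>a n * (b m * K)\<close>. With \<open>v k = (B ^^ k) x\<close> this multiplies two power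
  series in an operator.\<close>

lemma Cauchy_product_scaleR:
  fixes v :: "nat \<Rightarrow> 'a::banach" and a b :: "nat \<Rightarrow> real"
  assumes a: "summable a" "\<And>n. 0 \<le> a n" and b: "summable b" "\<And>n. 0 \<le> b n"
    and v: "\<And>n. norm (v n) \<le> K"
  shows "(\<Sum>n. a n *\<^sub>R (\<Sum>m. b m *\<^sub>R v (n + m))) = (\<Sum>k. (\<Sum>i\<le>k. a i * b (k - i)) *\<^sub>R v k)"
proof -
  have K: "0 \<le> K" by (rule order_trans[OF norm_ge_zero v])
  define F where "F = (\<lambda>(n, m). (a n * b m) *\<^sub>R v (n + m))"
  have sa: "a summable_on UNIV" and sb: "b summable_on UNIV"
    using a b by (auto intro!: norm_summable_imp_summable_on)
  define G where "G = (\<lambda>(n, m). a n * (b m * K))"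
  have "(\<lambda>p. norm (G p)) summable_on UNIV \<times> UNIV"
    unfolding Infinite_Sum.abs_summable_on_Sigma_iff
  proof (intro conjI ballI)
    show "(\<lambda>m. norm (G (n, m))) summable_on UNIV" for n
      using a b K sb by (simp add: G_def abs_mult summable_on_cmult_left summable_on_cmult_right)
    have "(\<lambda>n. a n * (infsum b UNIV * K)) summable_on UNIV"
      using sa by (rule summable_on_cmult_left)
    then show "(\<lambda>n. norm (\<Sum>\<^sub>\<infinity>m. norm (G (n, m)))) summable_on UNIV"
      using a b K infsum_nonneg[of UNIV b]
      by (simp add: G_def abs_mult infsum_cmult_left' infsum_cmult_right')
  qed
  then have "(\<lambda>p. norm (F p)) summable_on UNIV \<times> UNIV"
  proof (rule Infinite_Sum.abs_summable_on_comparison_test)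
    have "norm (F (n, m)) \<le> norm (G (n, m))" for n m
      using a(2)[of n] b(2)[of m] K v[of "n + m"]
      by (simp add: F_def G_def abs_mult mult.assoc mult_left_mono)
    then show "norm (F p) \<le> norm (G p)" for p
      by (cases p) simp
  qed
  then obtain s where s: "(F has_sum s) (UNIV \<times> UNIV)"
    using Infinite_Sum.abs_summable_summable[of F] unfolding summable_on_def by blast
  have "((\<lambda>n. a n *\<^sub>R (\<Sum>m. b m *\<^sub>R v (n + m))) has_sum s) UNIV"
  proof (rule has_sum_SigmaD[OF s])
    fix n
    have sm: "summable (\<lambda>m. norm (b m *\<^sub>R v (n + m)))"
      by (rule summable_comparison_test'[OF summable_mult2[OF b(1), of K]])
         (use b v in \<open>auto intro!: mult_left_mono\<close>)
    have "((\<lambda>m. b m *\<^sub>R v (n + m)) has_sum (\<Sum>m. b m *\<^sub>R v (n + m))) UNIV"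
      by (rule norm_summable_imp_has_sum[OF sm summable_sums[OF summable_norm_cancel[OF sm]]])
    from has_sum_bounded_linear[OF bounded_linear_scaleR_right this, of "a n"]
    show "((\<lambda>m. F (n, m)) has_sum a n *\<^sub>R (\<Sum>m. b m *\<^sub>R v (n + m))) UNIV"
      by (simp add: F_def)
  qed
  then have 1: "(\<Sum>n. a n *\<^sub>R (\<Sum>m. b m *\<^sub>R v (n + m))) = s"
    by (rule sums_unique[OF has_sum_imp_sums, symmetric])
  \<comment> \<open>Passage to antidiagonals: the pair \<open>(n, m)\<close> is relabelled as
    \<open>(n + m, n)\<close>.\<close>
  have "(F has_sum s) (UNIV \<times> UNIV) \<longleftrightarrow>
      ((\<lambda>(k, i). F (i, k - i)) has_sum s) (Sigma UNIV (\<lambda>k. {..k}))"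
    by (rule has_sum_reindex_bij_witness[where i = "\<lambda>(k, i). (i, k - i)"
          and j = "\<lambda>(n, m). (n + m, n)"]) auto
  with s have s': "((\<lambda>(k, i). F (i, k - i)) has_sum s) (Sigma UNIV (\<lambda>k. {..k}))"
    by blast
  have "((\<lambda>k. \<Sum>i\<le>k. F (i, k - i)) has_sum s) UNIV"
    by (rule has_sum_SigmaD[OF s']) (simp add: has_sum_finiteI)
  then have "(\<lambda>k. \<Sum>i\<le>k. F (i, k - i)) sums s"
    by (rule has_sum_imp_sums)
  then have 2: "(\<lambda>k. (\<Sum>i\<le>k. a i * b (k - i)) *\<^sub>R v k) sums s"
    by (simp add: F_def scaleR_sum_left)
  show ?thesis
    using 1 sums_unique[OF 2] by simp
qed

section \<open>Coefficients of the square root series\<close>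

text \<open>The Taylor coefficients of \<open>d z = (1 - sqrt (1 - z)) / z\<close>, read off from
  \<open>2 * d z = 1 + z * (d z)\<^sup>2\<close>; this form makes nonnegativity and summability evident.\<close>

fun sqrt_coeff :: "nat \<Rightarrow> real" where
  "sqrt_coeff 0 = 1 / 2"
| "sqrt_coeff (Suc n) = (\<Sum>i\<le>n. sqrt_coeff i * sqrt_coeff (n - i)) / 2"

declare sqrt_coeff.simps(2) [simp del]

lemma sqrt_coeff_nonneg: "0 \<le> sqrt_coeff n"
proof (induction n rule: less_induct)
  case (less n)
  then show ?case
    by (cases n) (auto simp: sqrt_coeff.simps(2) intro!: sum_nonneg)
qed

text \<open>The recurrence sums products over the triangle \<open>i + j \<le> n\<close>, which lies
  in the square \<open>{..n} \<times> {..n}\<close>. Hence each partial sum is at most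
  \<open>(1 + s\<^sup>2) / 2\<close> with \<open>s\<close> the preceding one, and this map preserves
  the bound 1.\<close>

lemma sum_sqrt_coeff_le: "(\<Sum>i\<le>n. sqrt_coeff i) \<le> 1"
proof (induction n)
  case (Suc n)
  let ?s = "\<Sum>i\<le>n. sqrt_coeff i"
  have "(\<Sum>i\<le>Suc n. sqrt_coeff i) = 1 / 2 + (\<Sum>k\<le>n. sqrt_coeff (Suc k))"
    by (simp add: sum.atMost_Suc_shift del: sum.atMost_Suc)
  also have "(\<Sum>k\<le>n. sqrt_coeff (Suc k)) =
      (\<Sum>k\<le>n. \<Sum>i\<le>k. sqrt_coeff i * sqrt_coeff (k - i)) / 2"
    by (simp add: sqrt_coeff.simps(2) sum_divide_distrib)
  also have "(\<Sum>k\<le>n. \<Sum>i\<le>k. sqrt_coeff i * sqrt_coeff (k - i)) =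
      (\<Sum>(i, j)\<in>{(i, j). i + j \<le> n}. sqrt_coeff i * sqrt_coeff j)"
    by (rule sum.triangle_reindex_eq[symmetric])
  also have "\<dots> \<le> (\<Sum>(i, j)\<in>{..n} \<times> {..n}. sqrt_coeff i * sqrt_coeff j)"
    by (rule sum_mono2) (auto simp: sqrt_coeff_nonneg)
  also have "\<dots> = ?s * ?s"
    by (simp add: sum_product sum.cartesian_product)
  also have "\<dots> \<le> 1 * 1"
    using Suc.IH by (intro mult_mono sum_nonneg) (auto simp: sqrt_coeff_nonneg)
  finally show ?case by simp
qed simp

lemma summable_sqrt_coeff: "summable sqrt_coeff"
  by (rule bounded_imp_summable[OF sqrt_coeff_nonneg sum_sqrt_coeff_le])

lemma suminf_sqrt_coeff_le: "suminf sqrt_coeff \<le> 1"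
proof -
  have "sum sqrt_coeff {..<n} \<le> 1" for n
    using sum_mono2[of "{..n}" "{..<n}" sqrt_coeff] sum_sqrt_coeff_le[of n] sqrt_coeff_nonneg
    by fastforce
  then show ?thesis
    by (rule suminf_le_const[OF summable_sqrt_coeff])
qed

text \<open>With \<open>d\<close> as above, \<open>I - B d(B)\<close> is the square root of \<open>I - B\<close>.\<close>

lemma positive_sqrt_diff_contraction:
  fixes B :: "'a::chilbert_space \<Rightarrow> 'a"
  assumes B: "bounded_clinear B"
    and selfadjoint: "\<And>x y. cinner (B x) y = cinner x (B y)"
    and contraction: "\<And>x. norm (B x) \<le> norm x"
  shows "\<exists>P. positive_op P \<and> (\<forall>x. P (P x) = x - B x)"
proof -
  have linB: "bounded_linear B" and BC: "\<And>c x. B (c *\<^sub>C x) = c *\<^sub>C B x"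
    using B by (auto simp: bounded_clinear_def)
  interpret B: bounded_linear B by fact
  have pow_le: "norm ((B ^^ n) x) \<le> norm x" for n x
    by (induction n) (auto intro: order_trans[OF contraction])
  have pow_add: "(B ^^ n) (x + y) = (B ^^ n) x + (B ^^ n) y" for n x y
    by (induction n) (auto simp: B.add)
  have pow_C: "(B ^^ n) (c *\<^sub>C x) = c *\<^sub>C (B ^^ n) x" for n c x
    by (induction n) (auto simp: BC)
  have pow_adj: "cinner ((B ^^ n) x) y = cinner x ((B ^^ n) y)" for n x y
    by (induction n arbitrary: y) (simp_all add: selfadjoint, simp add: funpow_swap1)
  have pow_lin: "bounded_linear (B ^^ n)" for n
    using bounded_clinear_intro[of "B ^^ n" 1] pow_add pow_C pow_le
    by (simp add: bounded_clinear_def)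
  \<comment> \<open>This is \<open>d(B)\<close>. The series converges absolutely, since powers of a
    contraction are contractions; as the coefficients sum to at most 1, \<open>D\<close> is itself a
    contraction.\<close>
  define D where "D x = (\<Sum>n. sqrt_coeff n *\<^sub>R (B ^^ n) x)" for x
  have le: "norm (sqrt_coeff n *\<^sub>R (B ^^ n) x) \<le> sqrt_coeff n * norm x" for n x
    using pow_le[of n x] by (simp add: sqrt_coeff_nonneg mult_left_mono)
  have summable_norm: "summable (\<lambda>n. norm (sqrt_coeff n *\<^sub>R (B ^^ n) x))" for x
    by (rule summable_comparison_test'[OF summable_mult2[OF summable_sqrt_coeff, of "norm x"]])
       (use le in auto)
  then have summable: "summable (\<lambda>n. sqrt_coeff n *\<^sub>R (B ^^ n) x)" for x
    by (rule summable_norm_cancel)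
  have D_le: "norm (D x) \<le> norm x" for x
  proof -
    have "norm (D x) \<le> (\<Sum>n. sqrt_coeff n * norm x)"
      unfolding D_def
      by (rule norm_suminf_le[OF le]) (rule summable_mult2[OF summable_sqrt_coeff])
    also have "\<dots> = suminf sqrt_coeff * norm x"
      by (rule suminf_mult2[OF summable_sqrt_coeff, symmetric])
    also have "\<dots> \<le> 1 * norm x"
      by (rule mult_right_mono[OF suminf_sqrt_coeff_le]) simp
    finally show ?thesis by simp
  qed
  have D_add: "D (x + y) = D x + D y" for x y
    unfolding D_def by (simp add: pow_add scaleR_add_right suminf_add summable)
  have D_C: "D (c *\<^sub>C x) = c *\<^sub>C D x" for c x
    unfolding D_def bounded_linear.suminf[OF bounded_linear_scaleC summable]
    by (simp add: pow_C scaleR_scaleC scaleC_scaleC mult.commute)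
  have D_adj: "cinner (D x) y = cinner x (D y)" for x y
    unfolding D_def bounded_linear.suminf[OF bounded_linear_cinner_left summable]
      bounded_linear.suminf[OF bounded_linear_cinner_right summable]
    by (simp add: cinner_scaleR_left cinner_scaleR_right pow_adj)
  have pow_D: "(B ^^ n) (D x) = (\<Sum>m. sqrt_coeff m *\<^sub>R (B ^^ (n + m)) x)" for n x
    unfolding D_def bounded_linear.suminf[OF pow_lin summable]
    by (simp add: linear_scale[OF bounded_linear.linear[OF pow_lin]] funpow_add)
  have BD: "B (D x) = D (B x)" for x
    using pow_D[of 1 x] by (simp add: D_def funpow_swap1)
  \<comment> \<open>The Cauchy product produces the convolution of the coefficients with themselves,
    which the recurrence identifies with \<open>2 * sqrt_coeff (Suc k)\<close>.\<close>
  have DD: "D (D x) = (\<Sum>k. (2 * sqrt_coeff (Suc k)) *\<^sub>R (B ^^ k) x)" for x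
  proof -
    have "D (D x) = (\<Sum>n. sqrt_coeff n *\<^sub>R (\<Sum>m. sqrt_coeff m *\<^sub>R (B ^^ (n + m)) x))"
      by (subst D_def) (simp add: pow_D)
    also have "\<dots> = (\<Sum>k. (\<Sum>i\<le>k. sqrt_coeff i * sqrt_coeff (k - i)) *\<^sub>R (B ^^ k) x)"
      by (rule Cauchy_product_scaleR[OF summable_sqrt_coeff sqrt_coeff_nonneg
            summable_sqrt_coeff sqrt_coeff_nonneg pow_le])
    finally show ?thesis
      by (simp add: sqrt_coeff.simps(2))
  qed
  \<comment> \<open>The operator form of \<open>z * (d z)\<^sup>2 = 2 * d z - 1\<close>: applying
    \<open>B\<close> raises each exponent by one, so the sum is twice the series of
    \<open>D x\<close> without its head \<open>(1 / 2) *\<^sub>R x\<close>.\<close>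
  have sq: "B (D (D x)) = 2 *\<^sub>R D x - x" for x
  proof -
    have S: "summable (\<lambda>k. sqrt_coeff (Suc k) *\<^sub>R (B ^^ k) x)"
    proof (rule summable_comparison_test')
      show "summable (\<lambda>k. sqrt_coeff (Suc k) * norm x)"
        using summable_sqrt_coeff by (intro summable_mult2) (simp add: summable_Suc_iff)
      show "norm (sqrt_coeff (Suc k) *\<^sub>R (B ^^ k) x) \<le> sqrt_coeff (Suc k) * norm x" for k
        using pow_le[of k x] by (simp add: sqrt_coeff_nonneg mult_left_mono)
    qed
    have "D (D x) = 2 *\<^sub>R (\<Sum>k. sqrt_coeff (Suc k) *\<^sub>R (B ^^ k) x)"
      unfolding DD suminf_scaleR_right[OF S] by simp
    then have "B (D (D x)) = 2 *\<^sub>R (\<Sum>k. sqrt_coeff (Suc k) *\<^sub>R (B ^^ Suc k) x)"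
      by (simp add: B.scaleR B.suminf[OF S])
    also have "(\<Sum>k. sqrt_coeff (Suc k) *\<^sub>R (B ^^ Suc k) x) = D x - (1 / 2) *\<^sub>R x"
      unfolding D_def using suminf_split_head[OF summable[of x]] by simp
    finally show ?thesis by (simp add: scaleR_diff_right)
  qed
  define P where "P x = x - B (D x)" for x
  have "bounded_clinear P"
  proof (rule bounded_clinear_intro)
    show "P (x + y) = P x + P y" for x y
      by (simp add: P_def D_add B.add)
    show "P (c *\<^sub>C x) = c *\<^sub>C P x" for c x
      using linear_diff[OF bounded_linear.linear[OF bounded_linear_scaleC], of c x "B (D x)"]
      by (simp add: P_def D_C BC)
    show "norm (P x) \<le> norm x * 2" for x
      using norm_triangle_ineq4[of x "B (D x)"] contraction[of "D x"] D_le[of x]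
      by (simp add: P_def)
  qed
  moreover have "cinner (P x) x \<in> \<real>\<^sub>\<ge>\<^sub>0" for x
  proof -
    \<comment> \<open>\<open>B\<close> and \<open>D\<close> are symmetric and commute, so their
      product is symmetric and its form is real. As the product is also a contraction, the form of
      \<open>P\<close> is nonnegative.\<close>
    have "cinner (B (D x)) x = cinner x (B (D x))"
      by (simp add: selfadjoint D_adj BD)
    also have "\<dots> = cnj (cinner (B (D x)) x)"
      by (rule cinner_commute)
    finally have "Im (cinner (B (D x)) x) = 0"
      by (simp add: complex_eq_iff)
    moreover have "Re (cinner (B (D x)) x) \<le> (norm x)\<^sup>2"
    proof -
      have "inner (B (D x)) x \<le> norm (B (D x)) * norm x"
        by (rule norm_cauchy_schwarz)
      also have "\<dots> \<le> norm x * norm x"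
        by (intro mult_right_mono order_trans[OF contraction D_le]) simp
      finally show ?thesis by (simp add: inner_eq_Re_cinner power2_eq_square)
    qed
    ultimately show ?thesis
      by (simp add: P_def cinner_diff_left cinner_self complex_nonneg_Reals_iff)
  qed
  moreover have "P (P x) = x - B x" for x
  proof -
    have DP: "D (P x) = D x - B (D (D x))"
    proof -
      have "D (P x + B (D x)) = D (P x) + D (B (D x))"
        by (rule D_add)
      moreover have "P x + B (D x) = x"
        by (simp add: P_def)
      ultimately show ?thesis
        by (simp add: BD[of "D x"] eq_diff_eq)
    qed
    have "P (P x) = P x - B (D (P x))"
      by (simp add: P_def)
    \<comment> \<open>Expanding \<open>(I - B D)\<^sup>2\<close> leaves
      \<open>I - 2 B D + B (B D D)\<close>, and \<open>sq\<close> replaces \<open>B D D\<close> by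
      \<open>2 D - I\<close>.\<close>
    also have "\<dots> = x - B x"
      unfolding DP sq by (simp add: P_def B.diff B.scaleR scaleR_2)
    finally show ?thesis .
  qed
  ultimately show ?thesis
    by (auto simp: positive_op_def)
qed

section \<open>The modulus of an operator\<close>

text \<open>It suffices to exhibit a witness for the choice in \<open>op_abs\<close>. The preceding
  lemma gives a root of \<open>I - B\<close> for a contraction \<open>B\<close>, so
  \<open>cadjoint A \<circ> A\<close> is first scaled by \<open>t\<close>, and the root is then
  divided by \<open>sqrt t\<close>.\<close>

lemma op_abs_square:
  fixes A :: "'a::chilbert_space \<Rightarrow> 'b::chilbert_space"
  assumes A: "bounded_clinear A"
  shows "op_abs A \<circ> op_abs A = cadjoint A \<circ> A"
proof -
  let ?T = "\<lambda>x. cadjoint A (A x)"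
  note adj = cinner_cadjoint[OF A]
  have adj': "cinner (cadjoint A y) x = cinner y (A x)" for x y
    by (metis adj cinner_commute)
  have linA: "bounded_linear A" and AC: "\<And>c x. A (c *\<^sub>C x) = c *\<^sub>C A x"
    using A by (auto simp: bounded_clinear_def)
  have linA': "bounded_linear (cadjoint A)"
    and AC': "\<And>c x. cadjoint A (c *\<^sub>C x) = c *\<^sub>C cadjoint A x"
    using bounded_clinear_cadjoint[OF A] by (auto simp: bounded_clinear_def)
  interpret A: bounded_linear A by fact
  interpret A': bounded_linear "cadjoint A" by fact
  obtain M where M: "\<And>y. norm (cadjoint A y) \<le> norm y * M" "0 < M"
    using A'.pos_bounded by auto
  \<comment> \<open>With \<open>t * M\<^sup>2 = 1\<close>, the quadratic term in the expansion of
    \<open>(norm (B x))\<^sup>2\<close> is at most half the negative cross term, so \<open>B\<close>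
    is a contraction. The bound \<open>M\<close> is taken strictly positive, which covers
    \<open>A = 0\<close>.\<close>
  define t where "t = 1 / M\<^sup>2"
  have t: "0 < t" using M(2) by (simp add: t_def)
  define B where "B x = x - t *\<^sub>R ?T x" for x
  have contraction: "norm (B x) \<le> norm x" for x
  proof -
    have "inner x (?T x) = (norm (A x))\<^sup>2"
      by (simp add: inner_eq_Re_cinner flip: adj) (simp add: cinner_self)
    then have "(norm (B x))\<^sup>2 = (norm x)\<^sup>2 - 2 * t * (norm (A x))\<^sup>2 + t\<^sup>2 * (norm (?T x))\<^sup>2"
      unfolding B_def power2_norm_eq_inner
      by (simp add: inner_diff inner_commute[of "?T x" x] algebra_simps power2_eq_square)
    also have "t\<^sup>2 * (norm (?T x))\<^sup>2 \<le> t\<^sup>2 * (norm (A x) * M)\<^sup>2"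
      by (intro mult_left_mono power_mono M(1)) auto
    also have "t\<^sup>2 * (norm (A x) * M)\<^sup>2 = t * (norm (A x))\<^sup>2"
      using M(2) by (simp add: t_def power2_eq_square)
    finally have "(norm (B x))\<^sup>2 \<le> (norm x)\<^sup>2 - t * (norm (A x))\<^sup>2"
      by simp
    also have "\<dots> \<le> (norm x)\<^sup>2"
      using t by simp
    finally show ?thesis
      by (rule power2_le_imp_le) simp
  qed
  have selfadjoint: "cinner (B x) y = cinner x (B y)" for x y
    by (simp add: B_def cinner_diff_left cinner_diff_right cinner_scaleR_left
        cinner_scaleR_right adj' flip: adj)
  have "bounded_clinear B"
  proof (rule bounded_clinear_intro)
    show "B (x + y) = B x + B y" for x y
      by (simp add: B_def A.add A'.add scaleR_add_right)
    show "B (c *\<^sub>C x) = c *\<^sub>C B x" for c x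
      using linear_diff[OF bounded_linear.linear[OF bounded_linear_scaleC], of c x "t *\<^sub>R ?T x"]
      by (simp add: B_def AC AC' scaleR_scaleC scaleC_scaleC mult.commute)
    show "norm (B x) \<le> norm x * 1" for x
      using contraction[of x] by simp
  qed
  from positive_sqrt_diff_contraction[OF this selfadjoint contraction]
  obtain Q where Q: "positive_op Q" "\<And>x. Q (Q x) = t *\<^sub>R ?T x"
    by (auto simp: B_def)
  define P where "P x = (1 / sqrt t) *\<^sub>R Q x" for x
  have linQ: "bounded_linear Q" and QC: "\<And>c x. Q (c *\<^sub>C x) = c *\<^sub>C Q x"
    and Qpos: "\<And>x. cinner (Q x) x \<in> \<real>\<^sub>\<ge>\<^sub>0"
    using Q(1) by (auto simp: positive_op_def bounded_clinear_def)
  interpret Q: bounded_linear Q by fact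
  have "bounded_clinear P"
    unfolding bounded_clinear_def
  proof (intro conjI allI)
    show "bounded_linear P"
      unfolding P_def by (rule bounded_linear_const_scaleR[OF linQ])
    show "P (c *\<^sub>C x) = c *\<^sub>C P x" for c x
      by (simp add: P_def QC scaleR_scaleC scaleC_scaleC mult.commute)
  qed
  moreover have "cinner (P x) x \<in> \<real>\<^sub>\<ge>\<^sub>0" for x
    using Qpos[of x] t by (auto simp: P_def cinner_scaleR_left complex_nonneg_Reals_iff)
  moreover have "P \<circ> P = cadjoint A \<circ> A"
    using t by (auto simp: fun_eq_iff P_def Q.scaleR Q(2))
  ultimately have "\<exists>P. positive_op P \<and> P \<circ> P = cadjoint A \<circ> A"
    by (auto simp: positive_op_def)
  from someI_ex[OF this, folded op_abs_def] show ?thesis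
    by blast
qed

text \<open>Moving the adjoint across the inner product leaves \<open>cinner (A x) (A x)\<close>.
  Squared, this is the fourth power in \<open>euclidean_dw_radius\<close>.\<close>

lemma cmod_cinner_op_abs_square:
  fixes A :: "'a::chilbert_space \<Rightarrow> 'a"
  assumes "bounded_clinear A"
  shows "cmod (cinner ((op_abs A ^^ 2) x) x) = (norm (A x))\<^sup>2"
proof -
  have "(op_abs A ^^ 2) x = cadjoint A (A x)"
    using fun_cong[OF op_abs_square[OF assms], of x] by (simp add: numeral_2_eq_2)
  then have "cinner ((op_abs A ^^ 2) x) x = cnj (cinner (A x) (A x))"
    by (metis cinner_cadjoint[OF assms] cinner_commute)
  then show ?thesis
    by (simp add: cinner_self norm_power)
qed

section \<open>Comparison of the radii\<close>

theorem theorem10: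
  fixes S :: "nat \<Rightarrow> 'a::chilbert_space \<Rightarrow> 'a" and n :: nat
  assumes "\<And>i. i \<in> {1..n} \<Longrightarrow> bounded_clinear (S i)"
  shows "max (euclidean_radius n S) (euclidean_radius n (\<lambda>i. op_abs (S i) ^^ 2))
           \<le> euclidean_dw_radius n S
         \<and> euclidean_dw_radius n S
           \<le> euclidean_radius n S + euclidean_radius n (\<lambda>i. op_abs (S i) ^^ 2)"
proof -
  define a where "a x = (\<Sum>i=1..n. (cmod (cinner (S i x) x))\<^sup>2)" for x
  define b where "b x = (\<Sum>i=1..n. norm (S i x) ^ 4)" for x
  have nonneg: "0 \<le> a x" "0 \<le> b x" for x
    by (simp_all add: a_def b_def sum_nonneg)
  let ?A = "insert 0 {sqrt (a x) | x. norm x = 1}"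
  let ?B = "insert 0 {sqrt (b x) | x. norm x = 1}"
  let ?C = "insert 0 {sqrt (a x + b x) | x. norm x = 1}"
  have A: "euclidean_radius n S = Sup ?A"
    by (simp add: euclidean_radius_def a_def)
  have "(\<Sum>i=1..n. (cmod (cinner ((op_abs (S i) ^^ 2) x) x))\<^sup>2) = b x" for x
    unfolding b_def
    by (rule sum.cong) (simp_all add: cmod_cinner_op_abs_square[OF assms] flip: power_mult)
  then have B: "euclidean_radius n (\<lambda>i. op_abs (S i) ^^ 2) = Sup ?B"
    by (simp only: euclidean_radius_def)
  have C: "euclidean_dw_radius n S = Sup ?C"
    by (simp add: euclidean_dw_radius_def a_def b_def sum.distrib)
  have "\<forall>i\<in>{1..n}. \<exists>K. \<forall>x. norm (S i x) \<le> norm x * K"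
    using assms bounded_linear.bounded unfolding bounded_clinear_def by blast
  then obtain K where K: "\<And>i x. i \<in> {1..n} \<Longrightarrow> norm (S i x) \<le> norm x * K i"
    by metis
  have a_le: "a x \<le> (\<Sum>i=1..n. (K i)\<^sup>2)" if "norm x = 1" for x
    unfolding a_def
  proof (intro sum_mono power_mono)
    fix i assume "i \<in> {1..n}"
    then show "cmod (cinner (S i x) x) \<le> K i"
      using norm_cinner_le[of "S i x" x] K[of i x] that by simp
  qed simp
  have b_le: "b x \<le> (\<Sum>i=1..n. K i ^ 4)" if "norm x = 1" for x
    unfolding b_def using K[of _ x] that by (intro sum_mono power_mono) auto
  \<comment> \<open>Boundedness of the operators makes all three sets bounded above; otherwise
    \<open>Sup\<close> on the reals would carry no information.\<close>
  have bddC: "bdd_above ?C"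
    using a_le b_le
    by (intro bdd_aboveI[where M = "sqrt ((\<Sum>i=1..n. (K i)\<^sup>2) + (\<Sum>i=1..n. K i ^ 4))"])
       (auto intro!: add_mono add_nonneg_nonneg sum_nonneg)
  have bddA: "bdd_above ?A"
    using a_le
    by (intro bdd_aboveI[where M = "sqrt (\<Sum>i=1..n. (K i)\<^sup>2)"]) (auto intro!: sum_nonneg)
  have bddB: "bdd_above ?B"
    using b_le
    by (intro bdd_aboveI[where M = "sqrt (\<Sum>i=1..n. K i ^ 4)"]) (auto intro!: sum_nonneg)
  have leA: "sqrt (a x) \<le> Sup ?A" and leB: "sqrt (b x) \<le> Sup ?B"
    and leC: "sqrt (a x + b x) \<le> Sup ?C" if "norm x = 1" for x
    by (rule cSup_upper, use that in blast, fact)+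
  \<comment> \<open>These bounds handle the inserted \<open>0\<close>, the only element of the sets
    when the space is trivial.\<close>
  have A0: "0 \<le> Sup ?A" and B0: "0 \<le> Sup ?B" and C0: "0 \<le> Sup ?C"
    by (rule cSup_upper[OF insertI1], fact)+
  have "Sup ?A \<le> Sup ?C"
  proof (rule cSup_least)
    fix r assume "r \<in> ?A"
    then consider "r = 0" | x where "norm x = 1" "r = sqrt (a x)" by blast
    then show "r \<le> Sup ?C"
    proof cases
      case (2 x)
      then have "r \<le> sqrt (a x + b x)" using nonneg by simp
      with leC[OF 2(1)] show ?thesis by linarith
    qed (use C0 in simp)
  qed simp
  moreover have "Sup ?B \<le> Sup ?C"
  proof (rule cSup_least)
    fix r assume "r \<in> ?B"
    then consider "r = 0" | x where "norm x = 1" "r = sqrt (b x)" by blast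
    then show "r \<le> Sup ?C"
    proof cases
      case (2 x)
      then have "r \<le> sqrt (a x + b x)" using nonneg by simp
      with leC[OF 2(1)] show ?thesis by linarith
    qed (use C0 in simp)
  qed simp
  moreover have "Sup ?C \<le> Sup ?A + Sup ?B"
  proof (rule cSup_least)
    fix r assume "r \<in> ?C"
    then consider "r = 0" | x where "norm x = 1" "r = sqrt (a x + b x)" by blast
    then show "r \<le> Sup ?A + Sup ?B"
    proof cases
      case (2 x)
      \<comment> \<open>The upper bound holds at each unit vector by subadditivity of the square
        root, and each summand is then bounded by its own supremum.\<close>
      with sqrt_add_le_add_sqrt[OF nonneg, of x x] leA[OF 2(1)] leB[OF 2(1)]
      show ?thesis by linarith
    qed (use A0 B0 in simp)
  qed simp
  ultimately show ?thesis
    by (simp add: A B C)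
qed

end
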